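(* For every positive integer $n$, the relation $\leq_t$ is a partial order on the class $\mathcal{T}_n$ of invertible trees on $2n$ vertices (trees being considered up to isomorphism).
   Context: For a graph $X$, $A(X)$ denotes its adjacency matrix. A tree $T$ is invertible if $A(T)$ is invertible; equivalently, $T$ has a perfect matching, which is then unique and denoted $M$. Edges of $M$ are called matching edges and all other edges are non-matching edges. The inverse graph $T^{-1}$ of an invertible tree $T$ is the graph on vertex set $V(T)$ in which distinct vertices $a,b$ are adjacent if and only if $(A(T)^{-1})_{a,b}\neq 0$ (the matrix $A(T)^{-1}$ has zero diagonal and entries in $\{0,\pm1\}$). Let $\phi$ be the involution of $V(T)$ that swaps the two ends of every edge of $M$; for a pair $e=uv$ write $\phi(e)=\phi(u)\phi(v)$, and let $\phi(T)$ be the tree on $V(T)$ with edge set $\{\phi(g): g\in E(T)\}$; it is a subgraph of $T^{-1}$. Tree-exchange: suppose $T^{-1}$ contains an edge $e\notin E(\phi(T))$ (so $\phi(e)\notin E(T)$). Let $f\in E(T)$ be any non-matching edge of $T$ lying on the fundamental cycle of $\phi(e)$, i.e. the unique cycle of $T\cup\{\phi(e)\}$. Let $\tau(T,e,f)$ be the tree obtained from $T$ by adding the edge $\phi(e)$ and removing the edge $f$; the set $M$ is also a perfect matching of $\tau(T,e,f)$. A tree $\widetilde{T}$ is obtained from $T$ by tree-exchange if $\widetilde{T}=\tau(T,e,f)$ for some such $e$ and $f$. The relation $\leq_t$ on $\mathcal{T}_n$ is the transitive closure of the relation given by: (a) $T\leq_t T$ for all $T\in\mathcal{T}_n$; and (b)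 $T\leq_t\widetilde{T}$ if $\widetilde{T}$ is isomorphic to a tree obtained from $T$ by tree-exchange. *)

theory Defs
  imports
    "Graph_Theory.Graph_Theory"
    "Jordan_Normal_Form.Gauss_Jordan_Elimination"
begin

text \<open>
  A finite simple graph is a \<open>pair_graph\<close>, i.e. a finite loopfree symmetric digraph without parallel
  arcs. An undirected edge \<open>uv\<close> is present as the two arcs \<open>(u, v)\<close> and \<open>(v, u)\<close>, which are therefore
  always added and removed together.
\<close>

text \<open>
  The library's \<open>tree\<close> cannot be used here: \<open>[(u, v), (v, u)]\<close> counts as a \<open>cycle\<close> of a symmetric
  digraph. The cycles of a simple graph are exactly the directed cycles of length at least 3.
\<close>

definition graph_cycle :: "'a pair_pre_digraph \<Rightarrow> ('a \<times> 'a) list \<Rightarrow> bool" where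
  "graph_cycle G p \<longleftrightarrow> pre_digraph.cycle (with_proj G) p \<and> 3 \<le> length p"

definition graph_tree :: "'a pair_pre_digraph \<Rightarrow> bool" where
  "graph_tree G \<longleftrightarrow> pair_graph G \<and> connected (with_proj G) \<and> \<not> (\<exists>p. graph_cycle G p)"

text \<open>Meaningful for graphs on the vertex set \<open>{0..<m}\<close> only.\<close>

definition adj_mat :: "nat pair_pre_digraph \<Rightarrow> real mat" where
  "adj_mat G = mat (card (pverts G)) (card (pverts G)) (\<lambda>(i, j). if (i, j) \<in> parcs G then 1 else 0)"

definition invertible_trees :: "nat \<Rightarrow> nat pair_pre_digraph set" where
  "invertible_trees n = {T. graph_tree T \<and> pverts T = {0..<2 * n} \<and> invertible_mat (adj_mat T)}"

definition inverse_graph :: "nat pair_pre_digraph \<Rightarrow> nat pair_pre_digraph" where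
  "inverse_graph T = \<lparr> pverts = pverts T,
     parcs = {(a, b). a \<in> pverts T \<and> b \<in> pverts T \<and> a \<noteq> b \<and>
                      the (mat_inverse (adj_mat T)) $$ (a, b) \<noteq> 0} \<rparr>"

definition perfect_matching :: "'a pair_pre_digraph \<Rightarrow> ('a \<times> 'a) set \<Rightarrow> bool" where
  "perfect_matching G M \<longleftrightarrow> M \<subseteq> parcs G \<and> sym M \<and> (\<forall>v \<in> pverts G. \<exists>!w. (v, w) \<in> M)"

text \<open>An invertible tree has exactly one perfect matching.\<close>

definition matching :: "'a pair_pre_digraph \<Rightarrow> ('a \<times> 'a) set" where
  "matching T = (THE M. perfect_matching T M)"

definition mate :: "'a pair_pre_digraph \<Rightarrow> 'a \<Rightarrow> 'a" where
  "mate T v = (THE w. (v, w) \<in> matching T)"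

definition mate_edge :: "'a pair_pre_digraph \<Rightarrow> 'a \<times> 'a \<Rightarrow> 'a \<times> 'a" where
  "mate_edge T = map_prod (mate T) (mate T)"

definition mate_tree :: "'a pair_pre_digraph \<Rightarrow> 'a pair_pre_digraph" where
  "mate_tree T = \<lparr> pverts = pverts T, parcs = mate_edge T ` parcs T \<rparr>"

definition add_edge :: "'a pair_pre_digraph \<Rightarrow> 'a \<times> 'a \<Rightarrow> 'a pair_pre_digraph" where
  "add_edge G e = \<lparr> pverts = pverts G, parcs = parcs G \<union> {e, prod.swap e} \<rparr>"

definition del_edge :: "'a pair_pre_digraph \<Rightarrow> 'a \<times> 'a \<Rightarrow> 'a pair_pre_digraph" where
  "del_edge G e = \<lparr> pverts = pverts G, parcs = parcs G - {e, prod.swap e} \<rparr>"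

definition exchange_pair :: "nat pair_pre_digraph \<Rightarrow> nat \<times> nat \<Rightarrow> nat \<times> nat \<Rightarrow> bool" where
  "exchange_pair T e f \<longleftrightarrow>
     e \<in> parcs (inverse_graph T) \<and> e \<notin> parcs (mate_tree T) \<and>
     f \<in> parcs T \<and> f \<notin> matching T \<and>
     (\<exists>p. graph_cycle (add_edge T (mate_edge T e)) p \<and> f \<in> set p)"

definition tau :: "'a pair_pre_digraph \<Rightarrow> 'a \<times> 'a \<Rightarrow> 'a \<times> 'a \<Rightarrow> 'a pair_pre_digraph" where
  "tau T e f = del_edge (add_edge T (mate_edge T e)) f"

definition tree_iso :: "nat \<Rightarrow> nat pair_pre_digraph rel" where
  "tree_iso n = {(T, S). T \<in> invertible_trees n \<and> S \<in> invertible_trees n \<and>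
                         digraph_iso (with_proj T) (with_proj S)}"

definition iso_class :: "nat \<Rightarrow> nat pair_pre_digraph \<Rightarrow> nat pair_pre_digraph set" where
  "iso_class n T = tree_iso n `` {T}"

definition tree_classes :: "nat \<Rightarrow> nat pair_pre_digraph set set" where
  "tree_classes n = invertible_trees n // tree_iso n"

text \<open>
  No membership of \<open>tau T e f\<close> in \<open>invertible_trees n\<close> is imposed: were it not an invertible tree, its
  class would be the empty set, which is not an element of \<open>tree_classes n\<close>.
\<close>

definition exchange_step :: "nat \<Rightarrow> nat pair_pre_digraph set rel" where
  "exchange_step n = {(iso_class n T, iso_class n (tau T e f)) | T e f.
                        T \<in> invertible_trees n \<and> exchange_pair T e f}"

definition tree_le :: "nat \<Rightarrow> nat pair_pre_digraph set rel" where
  "tree_le n = (Id_on (tree_classes n) \<union> exchange_step n)\<^sup>+"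

end

theory Submission
  imports Defs "Jordan_Normal_Form.Determinant"
begin

text \<open>
  Reflexivity and transitivity hold by construction, apart from the fact that a tree-exchange yields
  an invertible tree again. The point is antisymmetry, and for this it suffices to find a number that
  is an isomorphism invariant and strictly decreases under tree-exchange.

  Let \<open>m\<close> swap the two ends of each edge of the perfect matching, and write \<open>a \<rightarrow> b\<close> if \<open>m a\<close> and \<open>b\<close>
  are joined by a non-matching edge. A chain of arrows is an alternating path, so in a tree the
  arrows are acyclic (\<open>wf_arrows\<close>), and each arrow \<open>a \<rightarrow> b\<close> is the only chain from \<open>a\<close> to \<open>b\<close>
  (\<open>arrow_is_cover\<close>). If the entry of the inverse adjacency matrix at \<open>(a, b)\<close> is nonzero, then a
  chain of arrows leads from \<open>a\<close> to \<open>m b\<close> (\<open>inverse_graph_imp_reachable\<close>).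

  The invariant is the number of pairs that are joined by a nonempty chain of arrows. Exchange adds
  the edge between \<open>m a\<close> and \<open>m b\<close>, that is, the arrow \<open>a \<rightarrow> m b\<close> (and its mirror image
  \<open>b \<rightarrow> m a\<close>), a shortcut for a chain that exists already. It removes an edge between \<open>u\<close> and \<open>v\<close>,
  that is, the arrow \<open>m u \<rightarrow> v\<close>, which was a cover and cannot be replaced by a longer chain. So the
  set of joined pairs becomes strictly smaller (\<open>exchange_shrinks_reach\<close>).

  That the result is a tree is the usual exchange property of spanning trees; it has the same
  perfect matching. Invertibility is equivalent to the existence of a perfect matching: in one
  direction by the Leibniz formula (\<open>invertible_imp_matched_forest\<close>), in the other since a vector in the
  kernel with a nonzero entry would start an infinite chain of arrows (\<open>nonzero_propagates\<close>).
\<close>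

text \<open>From here on, \<open>adj_mat\<close> is the adjacency matrix of a graph, not the adjugate of a matrix.\<close>

hide_const (open) Determinant.adj_mat
hide_fact (open) Determinant.adj_mat_def

section \<open>Forests as relations in which every edge is a bridge\<close>

text \<open>
  A symmetric relation is the edge set of a forest iff each of its edges is a bridge. This form of
  acyclicity mentions no closed walks, so adding and removing edges reduces to reasoning about
  reflexive transitive closures.
\<close>

definition all_bridges :: "'a rel \<Rightarrow> bool" where
  "all_bridges E \<longleftrightarrow> sym E \<and> (\<forall>u v. (u, v) \<in> E \<longrightarrow> (u, v) \<notin> (E - {(u, v), (v, u)})\<^sup>*)"

lemma all_bridges_sym: "all_bridges E \<Longrightarrow> (u, v) \<in> E \<Longrightarrow> (v, u) \<in> E"
  unfolding all_bridges_def by (blast dest: symD)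

lemma all_bridges_irrefl: "all_bridges E \<Longrightarrow> (u, u) \<notin> E"
  by (auto simp: all_bridges_def)

lemma rtrancl_swap: "sym R \<Longrightarrow> (x, y) \<in> R\<^sup>* \<Longrightarrow> (y, x) \<in> R\<^sup>*"
  using Transitive_Closure.sym_rtrancl by (rule symD)

lemma sym_remove_edge: "sym E \<Longrightarrow> sym (E - {(u, v), (v, u)})"
  by (auto simp: sym_def)

text \<open>
  A walk that starts at \<open>x\<close> gains nothing from the arc \<open>(y, x)\<close>, which only returns to its start.
\<close>

lemma rtrancl_remove_reverse:
  assumes "(x, z) \<in> (E - {(x, y)})\<^sup>*"
  shows "(x, z) \<in> (E - {(x, y), (y, x)})\<^sup>*"
  using assms
proof (induction)
  case (step z z')
  show ?case
  proof (cases "z' = x")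
    case False
    then have "(z, z') \<in> E - {(x, y), (y, x)}" using step.hyps by auto
    then show ?thesis using step.IH by (rule rtrancl_into_rtrancl[rotated])
  qed simp
qed simp

lemma rtrancl_add_edge_cases:
  assumes "sym R" "(p, q) \<in> (R \<union> {(x, y), (y, x)})\<^sup>*"
  shows "(p, q) \<in> R\<^sup>* \<or> ((p, x) \<in> R\<^sup>* \<and> (y, q) \<in> R\<^sup>*) \<or> ((p, y) \<in> R\<^sup>* \<and> (x, q) \<in> R\<^sup>*)"
  using assms(2)
proof (induction)
  case (step q r)
  then show ?case
    using rtrancl_swap[OF assms(1)] by (auto intro: rtrancl_into_rtrancl rtrancl_trans)
qed simp

lemma all_bridges_subset: "all_bridges E \<Longrightarrow> sym S \<Longrightarrow> S \<subseteq> E \<Longrightarrow> all_bridges S"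
  unfolding all_bridges_def by (blast dest: subsetD[OF rtrancl_mono[OF Diff_mono[OF _ subset_refl]]])

text \<open>
  Joining two components of a forest leaves a forest: a detour around an old edge \<open>uv\<close> would have
  to use the new edge \<open>xy\<close>, and so would connect \<open>x\<close> to \<open>y\<close> through \<open>uv\<close> in the old forest.
\<close>

lemma all_bridges_add_edge:
  assumes S: "all_bridges S" and sep: "(x, y) \<notin> S\<^sup>*"
  shows "all_bridges (S \<union> {(x, y), (y, x)})"
proof -
  have symS: "sym S" using S by (simp add: all_bridges_def)
  have sep': "(y, x) \<notin> S\<^sup>*" using sep rtrancl_swap[OF symS] by blast
  have "(u, v) \<notin> (S \<union> {(x, y), (y, x)} - {(u, v), (v, u)})\<^sup>*" if uv: "(u, v) \<in> S \<union> {(x, y), (y, x)}" for u v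
  proof (cases "(u, v) \<in> S")
    case False
    then have "{(u, v), (v, u)} = {(x, y), (y, x)}" using uv by auto
    then have "(S \<union> {(x, y), (y, x)} - {(u, v), (v, u)})\<^sup>* \<subseteq> S\<^sup>*"
      by (intro rtrancl_mono) auto
    then show ?thesis using False uv sep sep' by auto
  next
    case True
    let ?S = "S - {(u, v), (v, u)}"
    have symS': "sym ?S" using symS by (rule sym_remove_edge)
    have sub: "?S\<^sup>* \<subseteq> S\<^sup>*" by (intro rtrancl_mono) auto
    have nuv: "(u, v) \<notin> ?S\<^sup>*" using S True by (auto simp: all_bridges_def)
    have vu: "(u, v) \<in> S\<^sup>*" "(v, u) \<in> S\<^sup>*"
      using True all_bridges_sym[OF S] by auto
    show ?thesis
    proof
      assume "(u, v) \<in> (S \<union> {(x, y), (y, x)} - {(u, v), (v, u)})\<^sup>*"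
      moreover have "(S \<union> {(x, y), (y, x)} - {(u, v), (v, u)})\<^sup>* \<subseteq> (?S \<union> {(x, y), (y, x)})\<^sup>*"
        by (intro rtrancl_mono) auto
      ultimately have "(u, v) \<in> (?S \<union> {(x, y), (y, x)})\<^sup>*" by auto
      from rtrancl_add_edge_cases[OF symS' this] nuv
      have "((u, x) \<in> S\<^sup>* \<and> (y, v) \<in> S\<^sup>*) \<or> ((u, y) \<in> S\<^sup>* \<and> (x, v) \<in> S\<^sup>*)"
        using sub by auto
      then have "(x, y) \<in> S\<^sup>*"
        using vu rtrancl_swap[OF symS] by (meson rtrancl_trans)
      then show False using sep by simp
    qed
  qed
  then show ?thesis using symS by (auto simp: all_bridges_def sym_def)
qed

text \<open>
  If \<open>uv\<close> can be bypassed with the help of the new edge \<open>xy\<close>, then \<open>x\<close> and \<open>y\<close> lie in different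
  components once \<open>uv\<close> is gone, since otherwise the bypass would exist already in \<open>E - uv\<close>. Hence
  the exchange is a deletion followed by the joining of two components.
\<close>

lemma all_bridges_exchange:
  assumes E: "all_bridges E" and f: "(u, v) \<in> E" and g: "(x, y) \<notin> E"
    and conn: "(u, v) \<in> (E \<union> {(x, y), (y, x)} - {(u, v), (v, u)})\<^sup>*"
  shows "all_bridges (E \<union> {(x, y), (y, x)} - {(u, v), (v, u)})"
proof -
  let ?S = "E - {(u, v), (v, u)}"
  have symS: "sym ?S" using E by (auto simp: all_bridges_def intro: sym_remove_edge)
  have S: "all_bridges ?S" using all_bridges_subset[OF E symS] by auto
  have eq: "E \<union> {(x, y), (y, x)} - {(u, v), (v, u)} = ?S \<union> {(x, y), (y, x)}"
    using f g all_bridges_sym[OF E] by auto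
  have nuv: "(u, v) \<notin> ?S\<^sup>*" using E f by (auto simp: all_bridges_def)
  have "(x, y) \<notin> ?S\<^sup>*"
  proof
    assume xy: "(x, y) \<in> ?S\<^sup>*"
    then have "(?S \<union> {(x, y), (y, x)}) \<subseteq> ?S\<^sup>*" using rtrancl_swap[OF symS] by auto
    then have "(?S \<union> {(x, y), (y, x)})\<^sup>* \<subseteq> ?S\<^sup>*" by (rule rtrancl_subset_rtrancl)
    then show False using conn nuv unfolding eq by auto
  qed
  then show ?thesis unfolding eq by (rule all_bridges_add_edge[OF S])
qed

text \<open>
  An infinite walk in a finite forest must turn back at some point: up to its first repeated vertex,
  a walk that never does traces a cycle. Three arguments below rest on this: walks along the powers
  of a permutation, along two competing matchings, and along an infinite alternating path.
\<close>

lemma all_bridges_backtrack: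
  assumes E: "all_bridges E" and fin: "finite E" and w: "\<And>i. (w i, w (Suc i)) \<in> E"
  shows "\<exists>i. w (Suc (Suc i)) = w i"
proof (rule ccontr)
  assume nb: "\<nexists>i. w (Suc (Suc i)) = w i"
  have "w i \<in> fst ` E" for i using imageI[OF w[of i], of fst] by simp
  then have "range w \<subseteq> fst ` E" by blast
  then have "finite (range w)" using fin finite_surj by blast
  then have "\<not> inj w" using finite_imageD infinite_UNIV_nat by blast
  then have ex: "\<exists>j. \<exists>i<j. w i = w j" by (metis injI linorder_neqE_nat)
  define j where "j = (LEAST j. \<exists>i<j. w i = w j)"
  obtain i where i: "i < j" "w i = w j"
    using LeastI_ex[OF ex] unfolding j_def by blast
  have inj: "w k \<noteq> w l" if "k < l" "l < j" for k l
    using not_less_Least[of l "\<lambda>j. \<exists>i<j. w i = w j"] that unfolding j_def by blast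
  let ?R = "E - {(w (Suc i), w i), (w i, w (Suc i))}"
  have "(w (Suc i), w k) \<in> ?R\<^sup>*" if "Suc i \<le> k" "k \<le> j" for k
    using that
  proof (induction k rule: dec_induct)
    case (step k)
    then have k: "i < k" "k < j" by auto
    have "w k \<noteq> w i" using inj[OF k] by metis
    moreover have "w (Suc k) \<noteq> w i" if "w k = w (Suc i)"
    proof -
      have "\<not> Suc i < k" using inj[of "Suc i" k] that k by metis
      then have "k = Suc i" using k by simp
      then show ?thesis using nb by metis
    qed
    ultimately have "(w k, w (Suc k)) \<in> ?R" using w[of k] by blast
    then show ?case using step.IH k by (meson less_imp_le rtrancl_into_rtrancl)
  qed simp
  from this[of j] have "(w (Suc i), w i) \<in> ?R\<^sup>*" using i by auto
  moreover have "(w (Suc i), w i) \<in> E" using all_bridges_sym[OF E w] .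
  ultimately show False using E unfolding all_bridges_def by metis
qed

section \<open>Matched forests and their arrows\<close>

locale matched_forest =
  fixes V :: "'a set" and E :: "'a rel" and m :: "'a \<Rightarrow> 'a"
  assumes fin: "finite V" and wf_E: "E \<subseteq> V \<times> V" and bridges: "all_bridges E"
    and mate_edge: "v \<in> V \<Longrightarrow> (v, m v) \<in> E"
    and mate_mate: "v \<in> V \<Longrightarrow> m (m v) = v"
begin

text \<open>
  Contract every matching edge, and orient each non-matching edge \<open>m a - b\<close> as \<open>a \<rightarrow> b\<close>. Read
  in the forest, a chain \<open>a \<rightarrow> \<dots> \<rightarrow> c\<close> is the alternating path from \<open>a\<close> over \<open>m a\<close> and so on to
  \<open>m c\<close>, which starts and ends with a matching edge. Each non-matching edge occurs twice, as
  \<open>a \<rightarrow> b\<close> and as \<open>m b \<rightarrow> m a\<close>; this spares the choice of a bipartition.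
\<close>

definition arrows :: "'a rel" where
  "arrows = {(a, b). a \<in> V \<and> b \<noteq> a \<and> (m a, b) \<in> E}"

lemma finite_E: "finite E"
  using fin wf_E by (meson finite_SigmaI finite_subset)

lemma edge_sym: "(u, v) \<in> E \<Longrightarrow> (v, u) \<in> E"
  using all_bridges_sym[OF bridges] .

lemma mate_in_V: "v \<in> V \<Longrightarrow> m v \<in> V"
  using mate_edge wf_E by auto

lemma arrows_in_V: "arrows \<subseteq> V \<times> V"
  using wf_E by (auto simp: arrows_def)

lemma finite_trancl_arrows: "finite (arrows\<^sup>+)"
  using finite_subset[OF trancl_subset_Sigma[OF arrows_in_V]] fin by auto

lemma mate_eq_iff: "u \<in> V \<Longrightarrow> v \<in> V \<Longrightarrow> m u = v \<longleftrightarrow> u = m v"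
  using mate_mate by metis

text \<open>
  An infinite chain of arrows spells out an infinite alternating walk, and alternating walks never
  turn back.
\<close>

lemma wf_arrows: "wf (arrows\<inverse>)"
  unfolding wf_iff_no_infinite_down_chain
proof (rule notI, elim exE)
  fix f assume "\<forall>i. (f (Suc i), f i) \<in> arrows\<inverse>"
  then have f: "f i \<in> V" "f (Suc i) \<noteq> f i" "(m (f i), f (Suc i)) \<in> E" for i
    by (auto simp: arrows_def)
  \<comment> \<open>The walk is \<open>m (f 0), f 1, m (f 1), f 2, m (f 2), \<dots>\<close>.\<close>
  define w where "w k = (if even k then m (f (k div 2)) else f (Suc (k div 2)))" for k
  have "(w k, w (Suc k)) \<in> E" for k
    using f(3)[of "k div 2"] mate_edge[OF f(1)[of "Suc (k div 2)"]]
    by (auto simp: w_def)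
  then obtain k where k: "w (Suc (Suc k)) = w k"
    using all_bridges_backtrack[OF bridges finite_E] by blast
  have "m (f (Suc i)) \<noteq> m (f i)" for i using f(1,2) mate_mate by metis
  then show False using k f(2) by (auto simp: w_def split: if_splits)
qed

lemma acyclic_arrows: "acyclic arrows"
  using wf_acyclic[OF wf_arrows] by simp

lemma arrows_reverse:
  assumes "(a, b) \<in> arrows" shows "(m b, m a) \<in> arrows"
proof -
  have "a \<in> V" "b \<in> V" using assms arrows_in_V by auto
  then show ?thesis using assms mate_in_V mate_mate edge_sym
    unfolding arrows_def by (auto dest: mate_eq_iff)
qed

lemma reach_reverse: "(a, b) \<in> arrows\<^sup>+ \<Longrightarrow> (m b, m a) \<in> arrows\<^sup>+"
  by (induction rule: trancl_induct) (auto dest: arrows_reverse intro: trancl_into_trancl2)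

text \<open>
  The arrows are the covering pairs of the order that they generate: otherwise a second alternating
  walk would lead from \<open>m a\<close> to \<open>b\<close>, bypassing the bridge between them. This is why an exchange loses
  at least one reachable pair.
\<close>

lemma arrow_is_cover:
  assumes ab: "(a, b) \<in> arrows" and ac: "(a, c) \<in> arrows" and cb: "(c, b) \<in> arrows\<^sup>+"
  shows False
proof -
  let ?F = "E - {(m a, b)}"
  have V: "a \<in> V" "b \<in> V" "c \<in> V" using ab ac arrows_in_V by auto
  have "c \<noteq> b" using cb acyclic_arrows by (auto simp: acyclic_def)
  have "(m a, y) \<in> ?F\<^sup>* \<and> y \<in> V" if "(c, y) \<in> arrows\<^sup>*" for y
    using that
  proof (induction)
    case base
    show ?case using ac \<open>c \<noteq> b\<close> V by (auto simp: arrows_def)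
  next
    case (step y z)
    have y: "y \<in> V" "z \<in> V" using step arrows_in_V by auto
    have "y \<noteq> a"
      using rtrancl_into_trancl2[OF ac step.hyps(1)] acyclic_arrows by (auto simp: acyclic_def)
    then have "m y \<noteq> m a" using mate_mate V y by metis
    then have "(m y, z) \<in> ?F" using step.hyps by (auto simp: arrows_def)
    moreover have "(y, m y) \<in> ?F"
      using mate_edge[OF y(1)] mate_mate V ab by (auto simp: arrows_def)
    ultimately show ?case using step.IH y by (auto intro: rtrancl_into_rtrancl)
  qed
  then have "(m a, b) \<in> ?F\<^sup>*" using cb by (simp add: trancl_into_rtrancl)
  then have "(m a, b) \<in> (E - {(m a, b), (b, m a)})\<^sup>*" by (rule rtrancl_remove_reverse)
  then show False using ab bridges by (auto simp: arrows_def all_bridges_def)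
qed

text \<open>
  This is all the linear algebra that is needed. Row \<open>m a\<close> of the product of the adjacency matrix with
  \<open>x\<close> is \<open>x a\<close> plus the sum of \<open>x\<close> over the arrow successors of \<open>a\<close>. If that row vanishes while
  \<open>x a \<noteq> 0\<close>, then some successor has a nonzero value as well, and by well-foundedness the search stops
  at a row that does not vanish. For \<open>x\<close> in the kernel this gives \<open>x = 0\<close>; for \<open>x\<close> a column of the
  inverse matrix it gives a chain of arrows between the ends of an edge of the inverse graph.
\<close>

lemma nonzero_propagates:
  fixes x :: "'a \<Rightarrow> 'b::comm_monoid_add"
  assumes "a \<in> V" "x a \<noteq> 0"
  shows "\<exists>c\<in>V. (a, c) \<in> arrows\<^sup>* \<and> (\<Sum>u | (m c, u) \<in> E. x u) \<noteq> 0"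
  using wf_arrows assms
proof (induction a rule: wf_induct_rule)
  case (less a)
  show ?case
  proof (cases "(\<Sum>u | (m a, u) \<in> E. x u) = 0")
    case True
    have split: "{u. (m a, u) \<in> E} = insert a {u. (a, u) \<in> arrows}"
      using less.prems(1) edge_sym[OF mate_edge[OF less.prems(1)]]
      unfolding arrows_def by blast
    have "finite {u. (a, u) \<in> arrows}"
      using arrows_in_V by (intro finite_subset[OF _ fin]) auto
    moreover have "a \<notin> {u. (a, u) \<in> arrows}" by (simp add: arrows_def)
    ultimately have sum: "x a + (\<Sum>u | (a, u) \<in> arrows. x u) = 0"
      using True unfolding split by simp
    have "\<exists>c. (a, c) \<in> arrows \<and> x c \<noteq> 0"
    proof (rule ccontr)
      assume "\<nexists>c. (a, c) \<in> arrows \<and> x c \<noteq> 0"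
      then have "(\<Sum>u | (a, u) \<in> arrows. x u) = 0" by (intro sum.neutral) auto
      then show False using sum less.prems by simp
    qed
    then obtain c where c: "(a, c) \<in> arrows" "x c \<noteq> 0" by blast
    moreover have "c \<in> V" using c arrows_in_V by auto
    ultimately obtain d where "d \<in> V" "(c, d) \<in> arrows\<^sup>*" "(\<Sum>u | (m d, u) \<in> E. x u) \<noteq> 0"
      using less.IH[of c] by auto
    then show ?thesis using c by (meson converse_rtrancl_into_rtrancl)
  qed (use less.prems in auto)
qed

text \<open>
  Where two matchings differ, using their edges in turn gives a walk that never turns back.
\<close>

lemma mate_unique:
  assumes "matched_forest V E m'" and "v \<in> V"
  shows "m' v = m v"
proof (rule ccontr)
  interpret other: matched_forest V E m' by fact
  assume neq: "m' v \<noteq> m v"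
  define w where "w = rec_nat v (\<lambda>k x. if even k then m x else m' x)"
  have w_Suc: "w (Suc k) = (if even k then m (w k) else m' (w k))" for k
    by (simp add: w_def)
  have inv: "w k \<in> V \<and> m' (w k) \<noteq> m (w k)" for k
  proof (induction k)
    case 0
    then show ?case using assms neq by (simp add: w_def)
  next
    case (Suc k)
    then show ?case unfolding w_Suc
      using mate_in_V other.mate_in_V mate_mate other.mate_mate by (metis (full_types))
  qed
  have "(w k, w (Suc k)) \<in> E" for k
    using inv[of k] by (auto simp: w_Suc mate_edge other.mate_edge)
  then obtain k where "w (Suc (Suc k)) = w k"
    using all_bridges_backtrack[OF bridges finite_E] by blast
  then show False
    using inv[of k] mate_mate other.mate_mate mate_in_V other.mate_in_V
    unfolding w_Suc by (metis even_Suc)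
qed

text \<open>
  The combinatorial core. The two arrows of the added edge, \<open>a \<rightarrow> m b\<close> and \<open>b \<rightarrow> m a\<close>, join pairs that
  were already reachable, so no reachable pair is gained. The arrow \<open>m u \<rightarrow> v\<close> of the deleted edge
  is lost: a new chain from \<open>m u\<close> to \<open>v\<close> could be expanded to a chain of old arrows that avoids this
  arrow, contradicting that it is a cover.
\<close>

lemma exchange_shrinks_reach:
  fixes a b u v
  defines "E' \<equiv> E \<union> {(m a, m b), (m b, m a)} - {(u, v), (v, u)}"
  assumes ab: "a \<in> V" "b \<in> V" and reach: "(a, m b) \<in> arrows\<^sup>*" and new: "(m a, m b) \<notin> E"
    and f: "(u, v) \<in> E" "v \<noteq> m u" and conn: "(u, v) \<in> E'\<^sup>*"
  shows "matched_forest V E' m"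
    and "(matched_forest.arrows V E' m)\<^sup>+ \<subset> arrows\<^sup>+"
proof -
  have V: "u \<in> V" "v \<in> V" "m u \<in> V" using f wf_E mate_in_V by auto
  have "u \<noteq> m v" using f V mate_eq_iff by metis
  show *: "matched_forest V E' m"
  proof
    show "E' \<subseteq> V \<times> V" using wf_E ab mate_in_V by (auto simp: E'_def)
    show "all_bridges E'" unfolding E'_def
      by (rule all_bridges_exchange[OF bridges f(1) new conn[unfolded E'_def]])
    show "(w, m w) \<in> E'" if "w \<in> V" for w
      using mate_edge[OF that] f(2) \<open>u \<noteq> m v\<close> by (auto simp: E'_def)
  qed (auto simp: fin mate_mate)
  interpret new: matched_forest V E' m by (rule *)
  have "a \<noteq> m b"
    using new mate_edge mate_mate ab mate_in_V by metis
  then have ab_reach: "(a, m b) \<in> arrows\<^sup>+" using reach by (simp add: rtrancl_eq_or_trancl)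
  then have ba_reach: "(b, m a) \<in> arrows\<^sup>+" using reach_reverse mate_mate ab by metis
  have not_arrow: "(a, m b) \<notin> arrows" "(b, m a) \<notin> arrows"
    using new edge_sym by (auto simp: arrows_def)
  have long: "(x, y) \<in> arrows O arrows\<^sup>+" if "(x, y) \<in> arrows\<^sup>+" "(x, y) \<notin> arrows" for x y
    using that by (metis relcomp.relcompI tranclD rtrancl_eq_or_trancl)
  \<comment> \<open>Each new arrow is an old one other than \<open>m u \<rightarrow> v\<close>, or stands for a chain of at least two old ones.\<close>
  have step: "(x, y) \<in> arrows - {(m u, v)} \<union> arrows O arrows\<^sup>+"
    if "(x, y) \<in> new.arrows" for x y
  proof -
    have x: "x \<in> V" "y \<noteq> x" "(m x, y) \<in> E'" using that by (auto simp: new.arrows_def)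
    consider "(m x, y) = (m a, m b)" | "(m x, y) = (m b, m a)" | "(m x, y) \<in> E - {(u, v)}"
      using x by (auto simp: E'_def)
    then show ?thesis
    proof cases
      case 1
      then have "x = a" "y = m b" using x ab mate_mate by (metis prod.inject)+
      then show ?thesis using long ab_reach not_arrow by auto
    next
      case 2
      then have "x = b" "y = m a" using x ab mate_mate by (metis prod.inject)+
      then show ?thesis using long ba_reach not_arrow by auto
    next
      case 3
      then show ?thesis using x V f wf_E mate_mate by (auto simp: arrows_def)
    qed
  qed
  then have "new.arrows \<subseteq> arrows\<^sup>+" by (auto intro: trancl_into_trancl2 dest!: step)
  then have sub: "new.arrows\<^sup>+ \<subseteq> arrows\<^sup>+"
    using trancl_mono_subset[of new.arrows "arrows\<^sup>+"] by simp
  have f_arrow: "(m u, v) \<in> arrows"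
    using f V wf_E mate_mate by (auto simp: arrows_def)
  have "(m u, v) \<notin> new.arrows\<^sup>+"
  proof
    assume "(m u, v) \<in> new.arrows\<^sup>+"
    then obtain c where c: "(m u, c) \<in> new.arrows" "c = v \<or> (c, v) \<in> arrows\<^sup>+"
      by (cases rule: converse_tranclE) (use sub in auto)
    have "\<exists>d. (m u, d) \<in> arrows \<and> (d, v) \<in> arrows\<^sup>+"
      using step[OF c(1)] c(2) by (auto intro: trancl_trans)
    then show False using arrow_is_cover[OF f_arrow] by blast
  qed
  then show "new.arrows\<^sup>+ \<subset> arrows\<^sup>+" using sub f_arrow by blast
qed

end

text \<open>
  The orbits of a permutation along the edges of a forest have at most two elements, since a longer
  orbit would be a cycle.
\<close>

lemma permutation_involution:
  assumes E: "all_bridges E" "finite E" and p: "inj p" and pE: "\<And>v. v \<in> V \<Longrightarrow> p v \<in> V \<and> (v, p v) \<in> E"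
    and "v \<in> V"
  shows "p (p v) = v"
proof -
  have V: "(p ^^ k) v \<in> V" for k using assms(5) pE by (induction k) auto
  have "((p ^^ k) v, (p ^^ Suc k) v) \<in> E" for k using V[of k] pE by simp
  then obtain k where "(p ^^ Suc (Suc k)) v = (p ^^ k) v"
    using all_bridges_backtrack[OF E, of "\<lambda>k. (p ^^ k) v"] by blast
  then have "(p ^^ k) (p (p v)) = (p ^^ k) v"
    by (simp only: funpow_Suc_right o_apply)
  then show ?thesis using inj_fn[OF p] by (simp only: inj_eq)
qed

section \<open>Forests given by the absence of cycles\<close>

lemma pcas_append: "pcas u (p @ q) v \<longleftrightarrow> (\<exists>w. pcas u p w \<and> pcas w q v)"
  by (induction p arbitrary: u) auto

lemma pcas_snd_last: "pcas u p v \<Longrightarrow> p \<noteq> [] \<Longrightarrow> v \<in> snd ` set p"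
  by (induction u p v rule: pcas.induct) (auto, metis image_eqI pcas.simps(1))

lemma pcas_rtrancl: "pcas u p v \<Longrightarrow> set p \<subseteq> R \<Longrightarrow> (u, v) \<in> R\<^sup>*"
proof (induction u p v rule: pcas.induct)
  case (2 u e es v)
  then have "(u, snd e) \<in> R" by (metis list.set_intros(1) pcas.simps(2) prod.collapse subsetD)
  then show ?case using 2 by (auto intro: converse_rtrancl_into_rtrancl)
qed auto

lemma pawalk_verts_conv: "pcas u p v \<Longrightarrow> pawalk_verts u p = u # map snd p"
  by (induction u p v rule: pcas.induct) auto

lemma graph_cycle_iff:
  "graph_cycle G p \<longleftrightarrow> set p \<subseteq> parcs G \<and> (\<exists>u \<in> pverts G. pcas u p u) \<and> distinct (map snd p) \<and> 3 \<le> length p"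
proof -
  have "distinct (tl (pawalk_verts u p)) \<longleftrightarrow> distinct (map snd p)" if "pcas u p u" for u
    using pawalk_verts_conv[OF that] by simp
  then show ?thesis
    unfolding graph_cycle_def pre_digraph.cycle_def pre_digraph.awalk_def
      cas_with_proj_eq awalk_verts_with_proj_eq with_proj_simps by auto
qed

text \<open>
  The rest of a cycle leads from \<open>v\<close> back to \<open>u\<close>. It avoids the reverse arc \<open>(v, u)\<close> because a cycle
  has length at least three.
\<close>

lemma graph_cycle_detour:
  assumes "graph_cycle G p" and uv: "(u, v) \<in> set p"
  shows "(v, u) \<in> (parcs G - {(u, v), (v, u)})\<^sup>*"
proof -
  obtain w where p: "set p \<subseteq> parcs G" "pcas w p w" "distinct (map snd p)" "3 \<le> length p"
    using assms(1) by (auto simp: graph_cycle_iff)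
  obtain p1 p2 where split: "p = p1 @ (u, v) # p2" using uv by (meson split_list)
  define r where "r = p2 @ p1"
  have r: "pcas v r u" "set r \<subseteq> parcs G" "distinct (v # map snd r)" "2 \<le> length r"
    using p by (auto simp: split r_def pcas_append)
  have "(v, u) \<notin> set r"
  proof
    assume "(v, u) \<in> set r"
    then obtain r1 r2 where r12: "r = r1 @ (v, u) # r2" by (meson split_list)
    then have "pcas v r1 v" "pcas u r2 u" using r by (auto simp: pcas_append)
    moreover have "v \<notin> snd ` set r1" "u \<notin> snd ` set r2" using r(3) by (auto simp: r12)
    ultimately have "r1 = []" "r2 = []" using pcas_snd_last by metis+
    then show False using r(4) by (simp add: r12)
  qed
  moreover have "(u, v) \<notin> set r" using r(3) by force
  ultimately show ?thesis using r by (intro pcas_rtrancl) auto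
qed

lemma graph_cycle_of_detour:
  assumes G: "pair_graph G" and uv: "(u, v) \<in> parcs G"
    and detour: "(u, v) \<in> (parcs G - {(u, v), (v, u)})\<^sup>*"
  shows "\<exists>p. graph_cycle G p"
proof -
  interpret pair_graph G by fact
  let ?H = "del_edge G (u, v)"
  interpret H: pair_wf_digraph ?H
    by unfold_locales (auto simp: del_edge_def dest: arc_fst_in_verts arc_snd_in_verts)
  have V: "u \<in> pverts G" "v \<in> pverts G" using uv by (auto dest: in_arcsD1 in_arcsD2)
  have "(u, v) \<in> rtrancl_on (pverts ?H) (parcs ?H)"
    using detour V by (intro rtrancl_consistent_rtrancl_on)
      (auto simp: del_edge_def dest: in_arcsD2)
  then have "\<exists>p. H.apath u p v"
    unfolding H.reachable_apath[symmetric] reachable_def by simp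
  then obtain p where "H.apath u p v" by blast
  then have p: "pcas u p v" "set p \<subseteq> parcs G - {(u, v), (v, u)}" "distinct (pawalk_verts u p)"
    unfolding H.apath_def H.awalk_def by (auto simp: del_edge_def)
  have dist: "distinct (u # map snd p)" using p pawalk_verts_conv by metis
  have vu: "(v, u) \<in> parcs G" using uv arcs_symmetric by blast
  have "u \<noteq> v" using uv no_loops' by blast
  have "2 \<le> length p"
  proof (rule ccontr)
    assume "\<not> 2 \<le> length p"
    then consider "p = []" | e where "p = [e]" by (cases p rule: list_exhaust_NSC) auto
    then show False using p \<open>u \<noteq> v\<close> by cases auto
  qed
  moreover have "pcas u (p @ [(v, u)]) u"
    unfolding pcas_append using p(1) by (intro exI[of _ v]) simp
  ultimately have "graph_cycle G (p @ [(v, u)])"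
    using p(2) dist vu V \<open>pcas u (p @ [(v, u)]) u\<close> unfolding graph_cycle_iff by auto
  then show ?thesis by blast
qed

lemma connected_iff_rtrancl:
  assumes "pair_graph G"
  shows "connected (with_proj G) \<longleftrightarrow>
    pverts G \<noteq> {} \<and> (\<forall>u\<in>pverts G. \<forall>v\<in>pverts G. (u, v) \<in> (parcs G)\<^sup>*)"
proof -
  interpret pair_graph G by fact
  have "symcl (parcs G) = parcs G" using arcs_symmetric by (auto simp: symcl_def)
  moreover have "(u, v) \<in> rtrancl_on (pverts G) (parcs G) \<longleftrightarrow> (u, v) \<in> (parcs G)\<^sup>*"
    if "u \<in> pverts G" "v \<in> pverts G" for u v
    using that by (auto intro: rtrancl_on_rtranclI rtrancl_consistent_rtrancl_on dest: in_arcsD2)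
  ultimately show ?thesis by (auto simp: connected_conv)
qed

lemma graph_tree_iff:
  "graph_tree G \<longleftrightarrow> finite (pverts G) \<and> pverts G \<noteq> {} \<and> parcs G \<subseteq> pverts G \<times> pverts G \<and>
     all_bridges (parcs G) \<and> (\<forall>u\<in>pverts G. \<forall>v\<in>pverts G. (u, v) \<in> (parcs G)\<^sup>*)"
    (is "_ \<longleftrightarrow> ?R")
proof
  assume T: "graph_tree G"
  then interpret pair_graph G by (simp add: graph_tree_def)
  have "all_bridges (parcs G)"
    unfolding all_bridges_def
    using graph_cycle_of_detour[OF pair_graph] T arcs_symmetric
    by (auto simp: graph_tree_def sym_def)
  then show ?R using T connected_iff_rtrancl[OF pair_graph] pair_finite_verts
    by (auto simp: graph_tree_def dest: in_arcsD1 in_arcsD2)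
next
  assume R: ?R
  have "pair_graph G"
    using R finite_subset[of "parcs G" "pverts G \<times> pverts G"] all_bridges_irrefl[of "parcs G"]
    by unfold_locales (auto simp: all_bridges_def Digraph.symmetric_def)
  moreover have "\<not> graph_cycle G p" for p
  proof
    assume cyc: "graph_cycle G p"
    then obtain u v where uv: "(u, v) \<in> set p" unfolding graph_cycle_iff by (cases p) auto
    then have "(u, v) \<in> parcs G" using cyc by (auto simp: graph_cycle_iff)
    then have "(v, u) \<in> parcs G" using R by (blast intro: all_bridges_sym)
    then show False using graph_cycle_detour[OF cyc uv] R
      unfolding all_bridges_def by (metis insert_commute)
  qed
  ultimately show "graph_tree G"
    using R connected_iff_rtrancl by (auto simp: graph_tree_def)
qed

section \<open>Perfect matchings of trees\<close>

lemma perfect_matching_of_mate: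
  assumes "matched_forest (pverts G) (parcs G) m"
  shows "perfect_matching G ((\<lambda>v. (v, m v)) ` pverts G)"
proof -
  interpret matched_forest "pverts G" "parcs G" m by fact
  show ?thesis
    unfolding perfect_matching_def
  proof (intro conjI ballI symI)
    show "(\<lambda>v. (v, m v)) ` pverts G \<subseteq> parcs G" using mate_edge by blast
    show "(w, v) \<in> (\<lambda>v. (v, m v)) ` pverts G" if "(v, w) \<in> (\<lambda>v. (v, m v)) ` pverts G" for v w
      using that mate_in_V mate_mate by (clarsimp simp: image_iff)
    show "\<exists>!w. (v, w) \<in> (\<lambda>v. (v, m v)) ` pverts G" if "v \<in> pverts G" for v
      using that by (intro ex1I[of _ "m v"]) auto
  qed
qed

lemma mate_of_perfect_matching:
  assumes G: "graph_tree G" and M: "perfect_matching G M"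
  defines "m \<equiv> \<lambda>v. THE w. (v, w) \<in> M"
  shows "matched_forest (pverts G) (parcs G) m" and "M = (\<lambda>v. (v, m v)) ` pverts G"
proof -
  have sub: "parcs G \<subseteq> pverts G \<times> pverts G" using G by (simp add: graph_tree_iff)
  have M': "M \<subseteq> parcs G" "sym M" "\<And>v. v \<in> pverts G \<Longrightarrow> \<exists>!w. (v, w) \<in> M"
    using M by (auto simp: perfect_matching_def)
  have m: "(v, m v) \<in> M" if "v \<in> pverts G" for v
    using theI'[OF M'(3)[OF that]] by (simp add: m_def)
  have m_eq: "m v = w" if "(v, w) \<in> M" for v w
    using that M'(1,3) sub unfolding m_def by (intro the1_equality) auto
  show "matched_forest (pverts G) (parcs G) m"
  proof
    show "m (m v) = v" if "v \<in> pverts G" for v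
      using m[OF that] M'(2) by (intro m_eq) (rule symD)
  qed (use G m M' in \<open>auto simp: graph_tree_iff\<close>)
  show "M = (\<lambda>v. (v, m v)) ` pverts G"
    using m m_eq M'(1) sub by (force simp: image_iff)
qed

lemma matching_eq:
  assumes G: "graph_tree G" and m: "matched_forest (pverts G) (parcs G) m"
  shows "matching G = (\<lambda>v. (v, m v)) ` pverts G"
proof -
  interpret matched_forest "pverts G" "parcs G" m by fact
  show ?thesis unfolding matching_def
  proof (rule the_equality)
    show "perfect_matching G ((\<lambda>v. (v, m v)) ` pverts G)"
      using m by (rule perfect_matching_of_mate)
    fix M assume M: "perfect_matching G M"
    let ?m = "\<lambda>v. THE w. (v, w) \<in> M"
    have "(\<lambda>v. (v, ?m v)) ` pverts G = (\<lambda>v. (v, m v)) ` pverts G"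
      using mate_unique[OF mate_of_perfect_matching(1)[OF G M]] by (intro image_cong) auto
    then show "M = (\<lambda>v. (v, m v)) ` pverts G"
      using mate_of_perfect_matching(2)[OF G M] by simp
  qed
qed

lemma mate_eq:
  assumes "graph_tree G" "matched_forest (pverts G) (parcs G) m" "v \<in> pverts G"
  shows "mate G v = m v"
  using assms(3) unfolding mate_def matching_eq[OF assms(1,2)] by auto

lemma matched_forest_mate:
  assumes G: "graph_tree G" and m: "matched_forest (pverts G) (parcs G) m"
  shows "matched_forest (pverts G) (parcs G) (mate G)"
proof -
  interpret matched_forest "pverts G" "parcs G" m by fact
  show ?thesis
  proof
    show "mate G (mate G v) = v" if "v \<in> pverts G" for v
      using that by (simp add: mate_eq[OF assms] mate_in_V mate_mate)
  qed (simp_all add: fin wf_E bridges mate_edge mate_eq[OF assms])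
qed

section \<open>Invertibility and the inverse graph\<close>

lemma invertible_mat_iff_Units:
  fixes A :: "'a :: field mat"
  assumes A: "A \<in> carrier_mat k k"
  shows "invertible_mat A \<longleftrightarrow> A \<in> Units (ring_mat TYPE('a) k b)"
proof
  assume "invertible_mat A"
  then obtain B where AB: "A * B = 1\<^sub>m k" "B * A = 1\<^sub>m (dim_row B)"
    using A by (auto simp: invertible_mat_def inverts_mat_def)
  have "dim_col B = k" using arg_cong[OF AB(1), of dim_col] by simp
  moreover have "dim_row B = k" using arg_cong[OF AB(2), of dim_col] A by simp
  ultimately have "B \<in> carrier_mat k k" by auto
  then show "A \<in> Units (ring_mat TYPE('a) k b)"
    using A AB by (auto simp: Units_def ring_mat_def)
next
  assume "A \<in> Units (ring_mat TYPE('a) k b)"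
  then show "invertible_mat A"
    using A by (auto simp: Units_def ring_mat_def invertible_mat_def inverts_mat_def)
qed

lemma invertible_mat_iff_det:
  fixes A :: "'a :: field mat"
  assumes "A \<in> carrier_mat k k"
  shows "invertible_mat A \<longleftrightarrow> det A \<noteq> 0"
  unfolding invertible_mat_iff_Units[OF assms, where b = "()"]
  by (rule iffI, erule unit_imp_det_non_zero, erule det_non_zero_imp_unit[OF assms])

lemma adj_mat_carrier: "pverts T = {0..<k} \<Longrightarrow> adj_mat T \<in> carrier_mat k k"
  by (simp add: adj_mat_def)

lemma adj_mat_index:
  "pverts T = {0..<k} \<Longrightarrow> i < k \<Longrightarrow> j < k \<Longrightarrow> adj_mat T $$ (i, j) = (if (i, j) \<in> parcs T then 1 else 0)"
  by (simp add: adj_mat_def)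

lemma adj_mat_row_sum:
  assumes "pverts T = {0..<k}" "parcs T \<subseteq> pverts T \<times> pverts T" "i < k" "dim_vec x = k"
  shows "row (adj_mat T) i \<bullet> x = (\<Sum>u | (i, u) \<in> parcs T. x $ u)"
proof -
  have "row (adj_mat T) i \<bullet> x = (\<Sum>u = 0..<k. if (i, u) \<in> parcs T then x $ u else 0)"
    using assms adj_mat_carrier[OF assms(1)]
    by (auto simp: scalar_prod_def adj_mat_index intro!: sum.cong)
  also have "\<dots> = sum (($) x) {u \<in> {0..<k}. (i, u) \<in> parcs T}"
    by (simp only: sum.inter_filter finite_atLeastLessThan)
  also have "{u \<in> {0..<k}. (i, u) \<in> parcs T} = {u. (i, u) \<in> parcs T}"
    using assms(1,2) by blast
  finally show ?thesis .
qed

text \<open>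
  A nonzero determinant has a nonzero term in its Leibniz expansion, that is, a permutation that moves
  every vertex along an edge. In a forest it is an involution, hence a perfect matching.
\<close>

lemma invertible_imp_matched_forest:
  assumes T: "graph_tree T" and V: "pverts T = {0..<k}" and inv: "invertible_mat (adj_mat T)"
  shows "\<exists>m. matched_forest (pverts T) (parcs T) m"
proof -
  have tree: "finite (pverts T)" "parcs T \<subseteq> pverts T \<times> pverts T" "all_bridges (parcs T)"
    using T by (simp_all add: graph_tree_iff)
  have "finite (parcs T)" using tree(1,2) by (meson finite_SigmaI finite_subset)
  have "det (adj_mat T) \<noteq> 0"
    using inv invertible_mat_iff_det[OF adj_mat_carrier[OF V]] by simp
  then obtain p where p: "p permutes {0..<k}" "(\<Prod>i = 0..<k. adj_mat T $$ (i, p i)) \<noteq> 0"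
    unfolding det_def'[OF adj_mat_carrier[OF V]]
    by (metis (no_types, lifting) mem_Collect_eq mult_zero_right sum.neutral)
  have pV: "p i \<in> pverts T" if "i \<in> pverts T" for i
    using that permutes_in_image[OF p(1)] V by simp
  have pE: "(i, p i) \<in> parcs T" if "i \<in> pverts T" for i
  proof -
    have "adj_mat T $$ (i, p i) \<noteq> 0" using p(2) that V by auto
    then show ?thesis using that pV[OF that] V by (auto simp: adj_mat_index split: if_splits)
  qed
  have "p (p v) = v" if "v \<in> pverts T" for v
    using permutation_involution[OF tree(3) \<open>finite (parcs T)\<close> permutes_inj[OF p(1)] _ that] pV pE
    by blast
  then have "matched_forest (pverts T) (parcs T) p"
    using tree pE by unfold_locales auto
  then show ?thesis by blast
qed

lemma matched_forest_imp_invertible: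
  assumes V: "pverts T = {0..<k}" and "matched_forest (pverts T) (parcs T) m"
  shows "invertible_mat (adj_mat T)"
proof (rule ccontr)
  interpret matched_forest "pverts T" "parcs T" m by fact
  assume "\<not> invertible_mat (adj_mat T)"
  then have "det (adj_mat T) = 0"
    using invertible_mat_iff_det[OF adj_mat_carrier[OF V]] by simp
  then obtain x where x: "x \<in> carrier_vec k" "x \<noteq> 0\<^sub>v k" "adj_mat T *\<^sub>v x = 0\<^sub>v k"
    using det_0_iff_vec_prod_zero_field[OF adj_mat_carrier[OF V]] by auto
  obtain a where a: "a \<in> pverts T" "x $ a \<noteq> 0" using x(1,2) V by (auto simp: vec_eq_iff)
  obtain c where c: "c \<in> pverts T" "(\<Sum>u | (m c, u) \<in> parcs T. x $ u) \<noteq> 0"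
    using nonzero_propagates[of a "\<lambda>u. x $ u"] a by auto
  have mc: "m c < k" using mate_in_V[OF c(1)] V by simp
  have "(adj_mat T *\<^sub>v x) $ m c = 0" using mc x(3) by simp
  then have "row (adj_mat T) (m c) \<bullet> x = 0"
    using mc adj_mat_carrier[OF V] by simp
  then show False
    using c(2) adj_mat_row_sum[OF V wf_E mc, of x] x(1) by simp
qed

text \<open>
  Apply \<open>nonzero_propagates\<close> to column \<open>b\<close> of the inverse matrix: its product with the adjacency matrix
  is nonzero in row \<open>b\<close> only.
\<close>

lemma inverse_graph_imp_reachable:
  assumes V: "pverts T = {0..<k}" and "matched_forest (pverts T) (parcs T) m"
    and ab: "(a, b) \<in> parcs (inverse_graph T)"
  shows "a \<in> pverts T \<and> b \<in> pverts T \<and>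
    (a, m b) \<in> (matched_forest.arrows (pverts T) (parcs T) m)\<^sup>*"
proof -
  interpret matched_forest "pverts T" "parcs T" m by fact
  let ?A = "adj_mat T"
  let ?B = "the (mat_inverse ?A)"
  have abV: "a \<in> pverts T" "b \<in> pverts T" "?B $$ (a, b) \<noteq> 0"
    using ab by (auto simp: inverse_graph_def)
  have A: "?A \<in> carrier_mat k k" by (rule adj_mat_carrier[OF V])
  have "mat_inverse ?A \<noteq> None"
    using mat_inverse(1)[OF A, of "()"] invertible_mat_iff_Units[OF A, of "()"]
      matched_forest_imp_invertible[OF assms(1,2)] by blast
  then have B: "?A * ?B = 1\<^sub>m k" "?B \<in> carrier_mat k k"
    using mat_inverse(2)[OF A, of ?B] by auto
  obtain c where c: "c \<in> pverts T" "(a, c) \<in> arrows\<^sup>*"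
    "(\<Sum>u | (m c, u) \<in> parcs T. col ?B b $ u) \<noteq> 0"
    using nonzero_propagates[of a "\<lambda>u. col ?B b $ u"] abV B(2) V by auto
  have mc: "m c < k" using mate_in_V[OF c(1)] V by simp
  have "(1\<^sub>m k :: real mat) $$ (m c, b) \<noteq> 0"
    using c(3) adj_mat_row_sum[OF V wf_E mc, of "col ?B b"] B(2) A mc abV V
    unfolding B(1)[symmetric] by simp
  then have "m c = b" using mc abV V by (simp split: if_splits)
  then show ?thesis using c abV mate_mate by auto
qed

lemma invertible_trees_iff:
  "T \<in> invertible_trees n \<longleftrightarrow> graph_tree T \<and> pverts T = {0..<2 * n} \<and>
     matched_forest (pverts T) (parcs T) (mate T)"
proof
  assume "T \<in> invertible_trees n"
  then have T: "graph_tree T" "pverts T = {0..<2 * n}" "invertible_mat (adj_mat T)"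
    by (simp_all add: invertible_trees_def)
  then obtain m where "matched_forest (pverts T) (parcs T) m"
    using invertible_imp_matched_forest by blast
  then show "graph_tree T \<and> pverts T = {0..<2 * n} \<and> matched_forest (pverts T) (parcs T) (mate T)"
    using T matched_forest_mate by blast
next
  assume T: "graph_tree T \<and> pverts T = {0..<2 * n} \<and> matched_forest (pverts T) (parcs T) (mate T)"
  then have "invertible_mat (adj_mat T)" using matched_forest_imp_invertible by blast
  then show "T \<in> invertible_trees n" using T by (simp add: invertible_trees_def)
qed

lemmas invertible_treesD = invertible_trees_iff[THEN iffD1, THEN conjunct1]
  invertible_trees_iff[THEN iffD1, THEN conjunct2, THEN conjunct1]
  invertible_trees_iff[THEN iffD1, THEN conjunct2, THEN conjunct2]

section \<open>The number of reachable pairs\<close>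

definition reach_pairs :: "'a pair_pre_digraph \<Rightarrow> 'a rel" where
  "reach_pairs T = (matched_forest.arrows (pverts T) (parcs T) (mate T))\<^sup>+"

text \<open>
  Translation of \<open>exchange_shrinks_reach\<close> to tree-exchange: an edge \<open>ab\<close> of the inverse graph provides
  the chain from \<open>a\<close> to the mate of \<open>b\<close>, and the fundamental cycle provides the bypass of the deleted
  edge. The bypass also keeps the tree connected.
\<close>

lemma tau_shrinks_reach:
  assumes T: "T \<in> invertible_trees n" and ef: "exchange_pair T e f"
  shows "tau T e f \<in> invertible_trees n"
    and "reach_pairs (tau T e f) \<subset> reach_pairs T"
proof -
  obtain a b u v where ef_eq: "e = (a, b)" "f = (u, v)" by (metis surj_pair)
  have tree: "graph_tree T" and V: "pverts T = {0..<2 * n}"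
    and mf: "matched_forest (pverts T) (parcs T) (mate T)"
    using T by (rule invertible_treesD)+
  interpret matched_forest "pverts T" "parcs T" "mate T" by (rule mf)
  let ?E' = "parcs T \<union> {(mate T a, mate T b), (mate T b, mate T a)} - {(u, v), (v, u)}"
  have tau: "pverts (tau T e f) = pverts T" "parcs (tau T e f) = ?E'"
    by (auto simp: tau_def add_edge_def del_edge_def mate_edge_def ef_eq)
  have ab: "a \<in> pverts T" "b \<in> pverts T" "(a, mate T b) \<in> arrows\<^sup>*"
    using inverse_graph_imp_reachable[OF V mf, of a b] ef by (auto simp: exchange_pair_def ef_eq)
  have new: "(mate T a, mate T b) \<notin> parcs T"
  proof
    assume "(mate T a, mate T b) \<in> parcs T"
    then have "mate_edge T (mate T a, mate T b) \<in> parcs (mate_tree T)"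
      by (simp add: mate_tree_def)
    then show False using ef ab mate_mate by (simp add: exchange_pair_def ef_eq mate_edge_def)
  qed
  have f: "(u, v) \<in> parcs T" "(u, v) \<notin> matching T" using ef by (auto simp: exchange_pair_def ef_eq)
  then have vu: "v \<noteq> mate T u"
    using matching_eq[OF tree mf] wf_E by auto
  obtain p where p: "graph_cycle (add_edge T (mate_edge T e)) p" "(u, v) \<in> set p"
    using ef by (auto simp: exchange_pair_def ef_eq)
  have sym': "sym ?E'" using edge_sym by (auto simp: sym_def)
  have "(v, u) \<in> ?E'\<^sup>*"
    using graph_cycle_detour[OF p] by (simp add: add_edge_def mate_edge_def ef_eq)
  then have uv: "(u, v) \<in> ?E'\<^sup>*" "(v, u) \<in> ?E'\<^sup>*" using rtrancl_swap[OF sym'] by auto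
  note ex = exchange_shrinks_reach[OF ab new f(1) vu uv(1)]
  interpret new: matched_forest "pverts T" ?E' "mate T" by (rule ex(1))
  have "parcs T \<subseteq> ?E'\<^sup>*" using uv by auto
  then have "(parcs T)\<^sup>* \<subseteq> ?E'\<^sup>*" by (rule rtrancl_subset_rtrancl)
  then have tree': "graph_tree (tau T e f)"
    using tree new.wf_E new.bridges unfolding graph_tree_iff tau by blast
  have mf': "matched_forest (pverts (tau T e f)) (parcs (tau T e f)) (mate T)"
    unfolding tau by (rule ex(1))
  then show "tau T e f \<in> invertible_trees n"
    using tree' V matched_forest_mate[OF tree' mf'] by (simp add: invertible_trees_iff tau)
  have "new.arrows = matched_forest.arrows (pverts T) ?E' (mate (tau T e f))"
    unfolding new.arrows_def
    using matched_forest_mate[OF tree' mf'] mate_eq[OF tree' mf']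
    by (auto simp: tau matched_forest.arrows_def)
  then show "reach_pairs (tau T e f) \<subset> reach_pairs T"
    using ex(2) by (simp add: reach_pairs_def tau)
qed

lemma trancl_image_inj_on:
  assumes "inj_on h V" "R \<subseteq> V \<times> V"
  shows "(map_prod h h ` R)\<^sup>+ = map_prod h h ` R\<^sup>+"
proof (intro equalityI subsetI)
  fix z assume "z \<in> (map_prod h h ` R)\<^sup>+"
  moreover obtain x y where "z = (x, y)" by fastforce
  ultimately have "(x, y) \<in> (map_prod h h ` R)\<^sup>+" by simp
  then have "(x, y) \<in> map_prod h h ` R\<^sup>+"
  proof (induction rule: trancl_induct)
    case (base y)
    then show ?case by auto
  next
    case (step y z)
    then obtain a b c d where ab: "(a, b) \<in> R\<^sup>+" "x = h a" "y = h b"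
      and cd: "(c, d) \<in> R" "y = h c" "z = h d" by auto
    have "b \<in> V" using trancl_subset_Sigma[OF assms(2)] ab by auto
    moreover have "c \<in> V" using assms(2) cd by auto
    ultimately have "b = c" using ab cd assms(1) by (metis inj_onD)
    then have "(a, d) \<in> R\<^sup>+" using ab cd by (meson trancl_into_trancl)
    then show ?case using ab cd by auto
  qed
  then show "z \<in> map_prod h h ` R\<^sup>+" using \<open>z = (x, y)\<close> by simp
next
  fix z assume "z \<in> map_prod h h ` R\<^sup>+"
  then obtain x y where xy: "(x, y) \<in> R\<^sup>+" "z = (h x, h y)" by auto
  from xy(1) have "(h x, h y) \<in> (map_prod h h ` R)\<^sup>+"
    by (induction rule: trancl_induct) (force intro: trancl_into_trancl)+
  then show "z \<in> (map_prod h h ` R)\<^sup>+" using xy by simp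
qed

text \<open>
  Uniqueness of the perfect matching makes an isomorphism commute with the mates, so that it carries
  arrows to arrows.
\<close>

lemma card_reach_pairs_iso:
  assumes "(T, S) \<in> tree_iso n"
  shows "card (reach_pairs T) = card (reach_pairs S)"
proof -
  have TS: "T \<in> invertible_trees n" "S \<in> invertible_trees n" "digraph_iso (with_proj T) (with_proj S)"
    using assms by (auto simp: tree_iso_def)
  interpret T: matched_forest "pverts T" "parcs T" "mate T" using TS(1) by (rule invertible_treesD)
  interpret S: matched_forest "pverts S" "parcs S" "mate S" using TS(2) by (rule invertible_treesD)
  obtain hom where hom: "pre_digraph.digraph_isomorphism (with_proj T) hom"
    "with_proj S = app_iso hom (with_proj T)"
    using TS(3) by (auto simp: digraph_iso_def)
  define h where "h = iso_verts hom"
  interpret wf_digraph "with_proj T" using hom(1) pre_digraph.digraph_isomorphism_def by blast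
  have inj: "inj_on h (pverts T)"
    using digraph_isomorphism_inj_on_verts[OF hom(1)] by (simp add: h_def)
  have pS: "pverts S = h ` pverts T"
    using arg_cong[OF hom(2), of verts] by (simp add: h_def)
  have aS: "parcs S = map_prod h h ` parcs T"
    using arg_cong[OF hom(2), of arcs_ends] arcs_ends_app_iso_eq[OF hom(1)]
    by (simp add: h_def map_prod_def)
  have aS_iff: "(h x, h y) \<in> parcs S \<longleftrightarrow> (x, y) \<in> parcs T" if "x \<in> pverts T" "y \<in> pverts T" for x y
    using that T.wf_E inj unfolding aS by (auto dest: inj_onD)
  define m' where "m' = h \<circ> mate T \<circ> the_inv_into (pverts T) h"
  have m': "m' (h v) = h (mate T v)" if "v \<in> pverts T" for v
    using the_inv_into_f_f[OF inj that] by (simp add: m'_def)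
  have "matched_forest (pverts S) (parcs S) m'"
  proof
    fix v assume "v \<in> pverts S"
    then obtain x where x: "x \<in> pverts T" "v = h x" by (auto simp: pS)
    show "(v, m' v) \<in> parcs S"
      unfolding x(2) m'[OF x(1)] aS_iff[OF x(1) T.mate_in_V[OF x(1)]]
      by (rule T.mate_edge[OF x(1)])
    show "m' (m' v) = v"
      unfolding x(2) m'[OF x(1)] m'[OF T.mate_in_V[OF x(1)]] T.mate_mate[OF x(1)] ..
  qed (fact S.fin S.wf_E S.bridges)+
  then have mS: "mate S (h v) = h (mate T v)" if "v \<in> pverts T" for v
    using S.mate_unique[of m' "h v"] m' that pS by simp
  have "S.arrows = map_prod h h ` T.arrows"
  proof (intro equalityI subsetI)
    fix z assume "z \<in> S.arrows"
    then obtain x y where xy: "z = (x, y)" "y \<noteq> x" "(mate S x, y) \<in> parcs S"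
      and "x \<in> pverts S" "y \<in> pverts S"
      using S.wf_E by (auto simp: S.arrows_def)
    then obtain a b where z: "z = (h a, h b)" "a \<in> pverts T" "b \<in> pverts T" "h b \<noteq> h a"
      "(mate S (h a), h b) \<in> parcs S"
      unfolding pS by blast
    then have "(a, b) \<in> T.arrows"
      using mS[OF z(2)] aS_iff[OF T.mate_in_V[OF z(2)] z(3)] by (auto simp: T.arrows_def)
    then show "z \<in> map_prod h h ` T.arrows" using z(1) by (simp add: map_prod_imageI)
  next
    fix z assume "z \<in> map_prod h h ` T.arrows"
    then obtain a b where z: "z = (h a, h b)" "(a, b) \<in> T.arrows" by auto
    then have V: "a \<in> pverts T" "b \<in> pverts T" using T.arrows_in_V by auto
    have "h b \<noteq> h a" using z(2) V inj_on_eq_iff[OF inj] by (auto simp: T.arrows_def)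
    moreover have "(mate S (h a), h b) \<in> parcs S"
      using z(2) mS[OF V(1)] aS_iff[OF T.mate_in_V[OF V(1)] V(2)] by (simp add: T.arrows_def)
    ultimately show "z \<in> S.arrows"
      unfolding S.arrows_def using z(1) V(1) by (simp add: pS)
  qed
  then have "reach_pairs S = map_prod h h ` reach_pairs T"
    using trancl_image_inj_on[OF inj T.arrows_in_V] by (simp add: reach_pairs_def)
  moreover have "inj_on (map_prod h h) (reach_pairs T)"
    unfolding reach_pairs_def
    by (rule inj_on_subset[OF map_prod_inj_on[OF inj inj] trancl_subset_Sigma[OF T.arrows_in_V]])
  ultimately show ?thesis by (simp add: card_image)
qed

lemma tree_iso_refl:
  assumes "T \<in> invertible_trees n" shows "(T, T) \<in> tree_iso n"
proof -
  have "pair_graph T" using assms by (simp add: invertible_trees_def graph_tree_def)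
  then interpret pair_graph T .
  let ?id = "\<lparr>iso_verts = id, iso_arcs = id, iso_head = snd, iso_tail = fst\<rparr>"
  have "pre_digraph.digraph_isomorphism (with_proj T) ?id"
    unfolding pre_digraph.digraph_isomorphism_def using wf_digraph_wp_iff pair_wf_digraph by auto
  moreover have "with_proj T = app_iso ?id (with_proj T)"
    by (simp add: app_iso_def with_proj_def)
  ultimately show ?thesis using assms by (auto simp: tree_iso_def digraph_iso_def)
qed

text \<open>
  The count of reachable pairs is constant on each isomorphism class, so its image there is a
  singleton.
\<close>

definition reach_number :: "nat pair_pre_digraph set \<Rightarrow> nat" where
  "reach_number X = the_elem ((\<lambda>T. card (reach_pairs T)) ` X)"

lemma reach_number_iso_class:
  assumes "T \<in> invertible_trees n"
  shows "reach_number (iso_class n T) = card (reach_pairs T)"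
proof -
  have T: "T \<in> iso_class n T" using tree_iso_refl[OF assms] by (simp add: iso_class_def)
  have "(\<lambda>S. card (reach_pairs S)) ` iso_class n T = (\<lambda>S. card (reach_pairs T)) ` iso_class n T"
  proof (rule image_cong[OF refl])
    show "card (reach_pairs S) = card (reach_pairs T)" if "S \<in> iso_class n T" for S
      using card_reach_pairs_iso[of T S n] that by (simp add: iso_class_def)
  qed
  then show ?thesis unfolding reach_number_def image_constant[OF T] by simp
qed

section \<open>The order on isomorphism classes\<close>

lemma exchange_step_decreases:
  assumes "(X, Y) \<in> exchange_step n"
  shows "X \<in> tree_classes n" "Y \<in> tree_classes n" "reach_number Y < reach_number X"
proof -
  obtain T e f where T: "T \<in> invertible_trees n" "exchange_pair T e f"
    and XY: "X = iso_class n T" "Y = iso_class n (tau T e f)"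
    using assms by (auto simp: exchange_step_def)
  note tau = tau_shrinks_reach[OF T]
  show "X \<in> tree_classes n" "Y \<in> tree_classes n"
    using T tau XY by (auto simp: tree_classes_def iso_class_def intro: quotientI)
  interpret matched_forest "pverts T" "parcs T" "mate T" using T(1) by (rule invertible_treesD)
  have "card (reach_pairs (tau T e f)) < card (reach_pairs T)"
    using tau(2) finite_trancl_arrows by (intro psubset_card_mono) (simp_all add: reach_pairs_def)
  then show "reach_number Y < reach_number X"
    using XY reach_number_iso_class T tau(1) by simp
qed

theorem theorem4p3:
  fixes n :: nat
  assumes "n > 0"
  shows "partial_order_on (tree_classes n) (tree_le n)"
proof -
  let ?C = "tree_classes n"
  let ?R = "Id_on ?C \<union> exchange_step n"
  have "exchange_step n \<subseteq> ?C \<times> ?C"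
    by (rule subrelI) (simp add: exchange_step_decreases(1,2))
  then have sub: "?R \<subseteq> ?C \<times> ?C" by (intro Un_least Id_on_subset_Times)
  have le: "X = Y \<or> reach_number Y < reach_number X" if "(X, Y) \<in> ?R\<^sup>+" for X Y
    using that
  proof (induction rule: trancl_induct)
    case (base Y)
    then show ?case using exchange_step_decreases(3) by (elim UnE) blast+
  next
    case (step Y Z)
    then have "Y = Z \<or> reach_number Z < reach_number Y"
      using exchange_step_decreases(3) by (elim UnE) blast+
    then show ?case using step.IH by (elim disjE) simp_all
  qed
  have "antisym (tree_le n)"
  proof (rule antisymI)
    fix X Y assume "(X, Y) \<in> tree_le n" "(Y, X) \<in> tree_le n"
    then show "X = Y" using le[of X Y] le[of Y X] by (auto simp: tree_le_def)
  qed
  moreover have "refl_on ?C (tree_le n)"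
    by (auto simp: refl_on_def tree_le_def)
  ultimately show ?thesis
    using trancl_subset_Sigma[OF sub]
    by (simp add: partial_order_on_def preorder_on_def tree_le_def)
qed

end
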